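(* Let $r(n,k)$ denote the number of partitions in $\mathcal Y_n$ of rank $k$. Then $$r(n,k)=\left(\frac{n+1-2k}{n+1-k}\binom{n}{k}\right)^2\quad\text{for all } 0\le k\le\left\lfloor\tfrac n2\right\rfloor.$$
   Context: $\mathcal Y_n$ is the set of partitions $\lambda=(\lambda_1,\dots,\lambda_{n-1})$ with $n-1\ge\lambda_1\ge\dots\ge\lambda_{n-1}\ge0$ and $\lambda_i\le n-i$ for all $i$ (i.e. partitions whose Young diagram fits in the shape $(n-1,n-2,\dots,1)$). The (Durfee) rank of a partition $\lambda$ is the largest integer $i$ with $\lambda_i\ge i$ (and $0$ for the empty partition), equivalently the length of the main diagonal of its Young diagram. *)

theory Defs
  imports Complex_Main
begin

text \<open>
  A partition with at most \<open>m\<close> parts is a list of length \<open>m\<close>, padded with zeros. List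
  positions start at \<open>0\<close>, so the part \<open>p\<^sub>i\<close> is \<^term>\<open>part p i\<close> for \<open>1 \<le> i \<le> m\<close>.
\<close>

definition part :: "nat list \<Rightarrow> nat \<Rightarrow> nat" where
  "part p i = p ! (i - 1)"

definition staircase_partitions :: "nat \<Rightarrow> nat list set" where
  "staircase_partitions n =
     {p. length p = n - 1 \<and> (\<forall>x\<in>set p. x \<le> n - 1) \<and> sorted_wrt (\<ge>) p \<and>
          (\<forall>i\<in>{1..n - 1}. part p i \<le> n - i)}"

text \<open>
  The element \<open>0\<close> makes the rank \<open>0\<close> for the empty partition, that is, for a list of zeros.
\<close>

definition durfee_rank :: "nat list \<Rightarrow> nat" where
  "durfee_rank p = Max (insert 0 {i \<in> {1..length p}. i \<le> part p i})"

definition rank_number :: "nat \<Rightarrow> nat \<Rightarrow> nat" where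
  "rank_number n k = card {p \<in> staircase_partitions n. durfee_rank p = k}"

lemma finite_staircase_partitions: "finite (staircase_partitions n)"
proof (rule finite_subset)
  show "staircase_partitions n \<subseteq> {p. set p \<subseteq> {..n - 1} \<and> length p = n - 1}"
    by (auto simp: staircase_partitions_def)
  show "finite {p. set p \<subseteq> {..n - 1} \<and> length p = n - 1}"
    by (rule finite_lists_length_eq) simp
qed

end

theory Submission
  imports Defs
begin

text \<open>
  A partition \<open>p\<close> of rank \<open>k\<close> consists of its \<open>k \<times> k\<close> Durfee square, the boxes to the right of
  the square and the boxes below it. With \<open>b = n - 1 - k\<close>, the boxes on the right form a partition
  with \<open>k\<close> parts whose \<open>j\<close>-th part (from \<open>j = 0\<close>) is at most \<open>b - j\<close>. The boxes below form a
  partition with \<open>b\<close> parts, subject to the same staircase bound \<open>b - j\<close> and with parts at most \<open>k\<close>.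
  The two pieces can be chosen independently, so \<open>r(n,k)\<close> is a product of two counts
  (\<open>rank_number_eq_prod\<close>).

  Both counts are instances of one problem: partitions with \<open>l\<close> parts, each at most \<open>c\<close>, below the
  staircase \<open>(b, b - 1, \<dots>)\<close>. Read as lattice paths in an \<open>l \<times> c\<close> rectangle that stay on one side of
  a line, they are counted by the reflection principle: there are
  \<open>(l + c choose c) - (l + c choose (b + 2))\<close> of them (\<open>card_capped_staircase\<close>). The first piece has
  \<open>(l, c) = (k, b)\<close> and the second \<open>(l, c) = (b, k)\<close>. The formula is symmetric in \<open>l\<close> and \<open>c\<close>
  (the symmetry is conjugation of partitions), so the product is a square. Its base
  \<open>((n - 1) choose k) - ((n - 1) choose (n + 1 - k))\<close> is the ballot number
  \<open>(n choose k) - (n choose (k - 1))\<close> (just \<open>1\<close> for \<open>k = 0\<close>), which is the closed form claimed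
  (\<open>ballot_number_eq\<close>).
\<close>

section \<open>Partitions below a staircase with bounded parts\<close>

text \<open>
  Truncated subtraction means that parts from position \<open>b\<close> on are forced to be \<open>0\<close>, as they should.
\<close>

definition capped_staircase :: "nat \<Rightarrow> nat \<Rightarrow> nat \<Rightarrow> nat list set" where
  "capped_staircase l b c =
     {p. length p = l \<and> sorted_wrt (\<ge>) p \<and> (\<forall>x\<in>set p. x \<le> c) \<and> (\<forall>j<l. p ! j \<le> b - j)}"

lemma finite_capped_staircase: "finite (capped_staircase l b c)"
proof (rule finite_subset)
  show "capped_staircase l b c \<subseteq> {p. set p \<subseteq> {..c} \<and> length p = l}"
    by (auto simp: capped_staircase_def)
  show "finite {p. set p \<subseteq> {..c} \<and> length p = l}"
    by (rule finite_lists_length_eq) simp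
qed

lemma capped_staircase_no_parts: "capped_staircase 0 b c = {[]}"
  by (auto simp: capped_staircase_def)

lemma capped_staircase_cap_0: "capped_staircase l b 0 = {replicate l 0}"
proof
  show "capped_staircase l b 0 \<subseteq> {replicate l 0}"
    by (auto simp: capped_staircase_def intro: replicate_eqI)
  show "{replicate l 0} \<subseteq> capped_staircase l b 0"
    by (auto simp: capped_staircase_def sorted_wrt_iff_nth_less)
qed

lemma Cons_in_capped_staircase_iff:
  "x # p \<in> capped_staircase (Suc l) b c \<longleftrightarrow> x \<le> b \<and> x \<le> c \<and> p \<in> capped_staircase l (b - 1) x"
  by (fastforce simp: capped_staircase_def All_less_Suc2)

text \<open>The largest part comes first, so a cap above the first stair excludes nothing.\<close>

lemma capped_staircase_cap_redundant:
  "capped_staircase (Suc l) b (Suc b) = capped_staircase (Suc l) b b" (is "?A = ?B")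
proof (rule set_eqI)
  fix p show "p \<in> ?A \<longleftrightarrow> p \<in> ?B"
  proof (cases p)
    case Nil
    then show ?thesis by (simp add: capped_staircase_def)
  next
    case (Cons x q)
    then show ?thesis by (auto simp: Cons_in_capped_staircase_iff)
  qed
qed

text \<open>
  The recursion splits off the partitions whose first part attains the cap. On lattice paths this is
  Pascal's rule, the two classes being the two possible directions of the first step.
\<close>

lemma card_capped_staircase_rec:
  assumes "Suc c \<le> b"
  shows "card (capped_staircase (Suc l) b (Suc c)) =
    card (capped_staircase (Suc l) b c) + card (capped_staircase l (b - 1) (Suc c))"
proof -
  let ?A = "capped_staircase (Suc l) b c"
  let ?B = "(#) (Suc c) ` capped_staircase l (b - 1) (Suc c)"
  have "capped_staircase (Suc l) b (Suc c) = ?A \<union> ?B"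
  proof (rule set_eqI)
    fix p show "p \<in> capped_staircase (Suc l) b (Suc c) \<longleftrightarrow> p \<in> ?A \<union> ?B"
    proof (cases p)
      case Nil
      then show ?thesis by (auto simp: capped_staircase_def)
    next
      case (Cons x q)
      then show ?thesis
        using assms by (auto simp: Cons_in_capped_staircase_iff le_Suc_eq)
    qed
  qed
  moreover have "?A \<inter> ?B = {}"
    by (auto simp: Cons_in_capped_staircase_iff)
  ultimately show ?thesis
    by (simp add: card_Un_disjoint finite_capped_staircase card_image)
qed

text \<open>
  The subtracted binomial coefficient in the reflection principle counts the paths that cross the
  line. The range \<open>l, c \<le> b + 1\<close> is where neither end of the path lies beyond the line; on its edge
  \<open>c = b + 1\<close> the formula agrees with the one for \<open>c = b\<close>, which is what lets the induction
  through when the cap exceeds the first stair.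
\<close>

lemma card_capped_staircase:
  assumes "l \<le> Suc b" and "c \<le> Suc b"
  shows "card (capped_staircase l b c) + ((l + c) choose (b + 2)) = (l + c) choose c"
  using assms
proof (induction l arbitrary: b c)
  case 0
  then show ?case by (simp add: capped_staircase_no_parts)
next
  case (Suc l)
  note IHl = Suc.IH and l = \<open>Suc l \<le> Suc b\<close>
  show ?case
    using Suc.prems(2)
  proof (induction c)
    case 0
    then show ?case using l by (simp add: capped_staircase_cap_0)
  next
    case (Suc c)
    have IHc: "card (capped_staircase (Suc l) b c) + ((l + Suc c) choose (b + 2)) =
        (l + Suc c) choose c"
      using Suc by simp
    show ?case
    proof (cases "Suc c \<le> b")
      case True
      then obtain b' where b: "b = Suc b'" by (cases b) auto
      have "card (capped_staircase l b' (Suc c)) + ((l + Suc c) choose (b' + 2)) =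
          (l + Suc c) choose Suc c"
        using l True b by (intro IHl) auto
      then show ?thesis
        using IHc card_capped_staircase_rec[OF True, of l] b by simp
    next
      case False
      then have "c = b" using Suc.prems by simp
      then show ?thesis
        using IHc by (simp add: capped_staircase_cap_redundant)
    qed
  qed
qed

section \<open>Splitting at the Durfee square\<close>

text \<open>
  In a decreasing sequence the index \<open>k\<close> alone decides whether the square of side \<open>k\<close> fits, and the
  index \<open>k + 1\<close> alone whether a larger one does. Spreading these two conditions over all parts gives
  the form in which the diagram can be cut along the square.
\<close>

lemma durfee_rank_eq_iff:
  assumes sorted: "sorted_wrt (\<ge>) p" and k: "k \<le> length p"
  shows "durfee_rank p = k \<longleftrightarrow>
    (\<forall>j<k. k \<le> p ! j) \<and> (\<forall>j. k \<le> j \<and> j < length p \<longrightarrow> p ! j \<le> k)"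
proof -
  let ?S = "insert 0 {i \<in> {1..length p}. i \<le> part p i}"
  have antimono: "p ! j \<le> p ! i" if "i \<le> j" "j < length p" for i j
    using sorted that by (cases "i = j") (auto simp: sorted_wrt_iff_nth_less)
  have fin: "finite ?S" by simp
  show ?thesis
  proof (intro iffI conjI allI impI)
    fix j assume rank: "durfee_rank p = k" and "j < k"
    have "k \<in> ?S"
      using Max_in[OF fin] rank by (auto simp: durfee_rank_def)
    then have "k \<le> p ! (k - 1)" using \<open>j < k\<close> by (simp add: part_def)
    also have "\<dots> \<le> p ! j" using \<open>j < k\<close> k by (intro antimono) auto
    finally show "k \<le> p ! j" .
  next
    fix j assume rank: "durfee_rank p = k" and j: "k \<le> j \<and> j < length p"
    have "Suc k \<notin> ?S"
    proof
      assume "Suc k \<in> ?S"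
      then have "Suc k \<le> Max ?S" by (rule Max_ge[OF fin])
      then show False using rank by (simp add: durfee_rank_def)
    qed
    then have "p ! k \<le> k" using j by (simp add: part_def)
    then show "p ! j \<le> k" using antimono[of k j] j by simp
  next
    assume *: "(\<forall>j<k. k \<le> p ! j) \<and> (\<forall>j. k \<le> j \<and> j < length p \<longrightarrow> p ! j \<le> k)"
    show "durfee_rank p = k"
      unfolding durfee_rank_def
    proof (rule Max_eqI[OF fin])
      show "k \<in> ?S" using * k by (cases k) (auto simp: part_def)
      fix i assume i: "i \<in> ?S"
      show "i \<le> k"
      proof (rule ccontr)
        assume "\<not> i \<le> k"
        then have "1 \<le> i" "i \<le> length p" "i \<le> p ! (i - 1)"
          using i by (auto simp: part_def)
        moreover from this have "p ! (i - 1) \<le> k"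
          using *[THEN conjunct2, rule_format, of "i - 1"] \<open>\<not> i \<le> k\<close> by linarith
        ultimately show False using \<open>\<not> i \<le> k\<close> by simp
      qed
    qed
  qed
qed

lemma staircase_partitions_iff_nth:
  "p \<in> staircase_partitions n \<longleftrightarrow>
     length p = n - 1 \<and> sorted_wrt (\<ge>) p \<and> (\<forall>j<n - 1. p ! j \<le> n - 1 - j)"
proof -
  have "(\<forall>i\<in>{1..n - 1}. part p i \<le> n - i) \<longleftrightarrow> (\<forall>j<n - 1. p ! j \<le> n - 1 - j)"
  proof
    assume *: "\<forall>i\<in>{1..n - 1}. part p i \<le> n - i"
    show "\<forall>j<n - 1. p ! j \<le> n - 1 - j"
    proof (intro allI impI)
      fix j assume "j < n - 1"
      then show "p ! j \<le> n - 1 - j"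
        using bspec[OF *, of "Suc j"] by (simp add: part_def)
    qed
  next
    assume *: "\<forall>j<n - 1. p ! j \<le> n - 1 - j"
    show "\<forall>i\<in>{1..n - 1}. part p i \<le> n - i"
    proof
      fix i assume "i \<in> {1..n - 1}"
      then show "part p i \<le> n - i"
        using *[rule_format, of "i - 1"] by (auto simp: part_def)
    qed
  qed
  moreover have "\<forall>x\<in>set p. x \<le> n - 1"
    if "length p = n - 1" "\<forall>j<n - 1. p ! j \<le> n - 1 - j"
    using that by (fastforce simp: in_set_conv_nth)
  ultimately show ?thesis
    by (auto simp: staircase_partitions_def)
qed

text \<open>
  The first factor lists the boxes to the right of the Durfee square, the second the rows below it.
  Adding \<open>k\<close> to the parts of the first puts the square back.
\<close>

lemma rank_number_eq_prod:
  assumes "1 \<le> n" and "k \<le> n div 2"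
  defines "b \<equiv> n - 1 - k"
  shows "rank_number n k = card (capped_staircase k b b) * card (capped_staircase b b k)"
proof -
  define glue where "glue = (\<lambda>(u, v). map ((+) k) u @ v)"
  let ?U = "capped_staircase k b b" and ?V = "capped_staircase b b k"
  let ?R = "{p \<in> staircase_partitions n. durfee_rank p = k}"
  have n: "n - 1 = k + b" and kb: "k \<le> Suc b"
    using assms by auto
  have R_iff: "p \<in> ?R \<longleftrightarrow> length p = k + b \<and> sorted_wrt (\<ge>) p \<and> (\<forall>j<k + b. p ! j \<le> k + b - j) \<and>
      (\<forall>j<k. k \<le> p ! j) \<and> (\<forall>j. k \<le> j \<and> j < k + b \<longrightarrow> p ! j \<le> k)" for p
    unfolding mem_Collect_eq staircase_partitions_iff_nth n
    using durfee_rank_eq_iff[of p k] by auto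
  have inj: "inj_on glue (?U \<times> ?V)"
    by (auto simp: inj_on_def glue_def capped_staircase_def inj_map_eq_map)
  have image: "glue ` (?U \<times> ?V) = ?R"
  proof (intro set_eqI iffI)
    fix p assume "p \<in> glue ` (?U \<times> ?V)"
    then obtain u v where p: "p = map ((+) k) u @ v" and u: "u \<in> ?U" and v: "v \<in> ?V"
      by (auto simp: glue_def)
    have len: "length u = k" "length v = b"
      using u v by (auto simp: capped_staircase_def)
    have nth_u: "p ! j = k + u ! j" if "j < k" for j
      using that len by (simp add: p nth_append)
    have nth_v: "p ! j = v ! (j - k)" if "k \<le> j" for j
      using that len by (simp add: p nth_append)
    have u_le: "u ! j \<le> b - j" if "j < k" for j
      using u that by (simp add: capped_staircase_def)
    have v_le: "v ! j \<le> b - j" "v ! j \<le> k" if "j < b" for j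
      using v that len by (auto simp: capped_staircase_def)
    have "p ! j \<le> k + b - j" if "j < k + b" for j
    proof (cases "j < k")
      case True
      \<comment> \<open>The subtraction \<open>b - j\<close> is not truncated, because \<open>j < k \<le> b + 1\<close>.\<close>
      then show ?thesis using u_le[of j] nth_u[of j] kb by simp
    next
      case False
      then show ?thesis using v_le[of "j - k"] nth_v[of j] that by (simp add: add.commute)
    qed
    moreover have "sorted_wrt (\<ge>) p"
      using u v by (force simp: p capped_staircase_def sorted_wrt_append sorted_wrt_map)
    moreover have "length p = k + b" using len by (simp add: p)
    moreover have "k \<le> p ! j" if "j < k" for j using nth_u that by simp
    moreover have "p ! j \<le> k" if "k \<le> j" "j < k + b" for j
      using nth_v[of j] v_le(2)[of "j - k"] that by simp
    ultimately show "p \<in> ?R" unfolding R_iff by simp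
  next
    fix p assume "p \<in> ?R"
    then have len: "length p = k + b" and sorted: "sorted_wrt (\<ge>) p"
      and stair: "\<And>j. j < k + b \<Longrightarrow> p ! j \<le> k + b - j"
      and ge: "\<And>j. j < k \<Longrightarrow> k \<le> p ! j"
      and le: "\<And>j. k \<le> j \<Longrightarrow> j < k + b \<Longrightarrow> p ! j \<le> k"
      unfolding R_iff by simp_all
    define u where "u = map (\<lambda>x. x - k) (take k p)"
    have "map ((+) k) u = take k p"
      using ge len by (intro nth_equalityI) (auto simp: u_def)
    then have "p = glue (u, drop k p)" by (simp add: glue_def)
    moreover have "u \<in> ?U"
    proof -
      have "sorted_wrt (\<ge>) u"
        using sorted len by (auto simp: u_def sorted_wrt_iff_nth_less intro!: diff_le_mono)
      moreover have "u ! j \<le> b - j" if "j < k" for j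
        using stair[of j] that len by (simp add: u_def)
      moreover from this have "\<forall>x\<in>set u. x \<le> b"
        using len by (fastforce simp: in_set_conv_nth u_def)
      ultimately show ?thesis
        using len by (simp add: capped_staircase_def) (simp add: u_def)
    qed
    moreover have "drop k p \<in> ?V"
    proof -
      have "drop k p ! j \<le> b - j" "drop k p ! j \<le> k" if "j < b" for j
        using stair[of "k + j"] le[of "k + j"] that len by simp_all
      then show ?thesis
        using len sorted by (auto simp: capped_staircase_def in_set_conv_nth sorted_wrt_drop)
    qed
    ultimately show "p \<in> glue ` (?U \<times> ?V)" by blast
  qed
  have "card ?R = card (?U \<times> ?V)"
    unfolding image[symmetric] by (rule card_image[OF inj])
  then show ?thesis
    by (simp add: rank_number_def card_cartesian_product)
qed

section \<open>The ballot number\<close>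

text \<open>
  For \<open>k > 0\<close> both sides equal \<open>(n choose k) - (n choose (k - 1))\<close>: the left-hand side by symmetry
  and Pascal's rule, where the term \<open>(n - 1) choose (k - 1)\<close> cancels, and the right-hand side because
  \<open>k (n choose k) = (n + 1 - k) (n choose (k - 1))\<close>.
\<close>

lemma ballot_number_eq:
  assumes "1 \<le> n" and "k \<le> n div 2"
  shows "real ((n - 1) choose k) - real ((n - 1) choose (n + 1 - k)) =
    (real n + 1 - 2 * real k) / (real n + 1 - real k) * real (n choose k)"
proof (cases k)
  case 0
  then show ?thesis using assms by simp
next
  case (Suc i)
  obtain m where m: "n = Suc m" using assms by (cases n) auto
  have i: "i < m" using assms by (auto simp: Suc m)
  have pascal: "n choose k = (m choose i) + (m choose k)"
    by (simp add: Suc m)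
  have "n choose i = n choose (n - i)"
    using i m by (intro binomial_symmetric) simp
  also have "\<dots> = (m choose (m - i)) + (m choose (Suc m - i))"
    using i m by (simp add: Suc_diff_le)
  also have "m choose (m - i) = m choose i"
    using i binomial_symmetric[of i m] by simp
  finally have pascal': "n choose i = (m choose i) + (m choose (n + 1 - k))"
    by (simp add: Suc m)
  have "k * (n choose k) = (n - i) * (n choose i)"
    unfolding Suc binomial_absorb_comp by (rule binomial_absorption)
  then have "real k * real (n choose k) = real (n - i) * real (n choose i)"
    by (metis of_nat_mult)
  then have absorb: "real k * real (n choose k) = (real n + 1 - real k) * real (n choose i)"
    using i m Suc by (simp add: of_nat_diff)
  have pos: "real n + 1 - real k > 0" using i m Suc by simp
  have "real ((n - 1) choose k) - real ((n - 1) choose (n + 1 - k)) =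
      real (n choose k) - real (n choose i)"
    unfolding pascal pascal' by (simp add: m)
  also have "\<dots> = real (n choose k) - real k * real (n choose k) / (real n + 1 - real k)"
    unfolding absorb using pos by simp
  also have "\<dots> = (real n + 1 - 2 * real k) / (real n + 1 - real k) * real (n choose k)"
    using pos by (simp add: field_simps)
  finally show ?thesis .
qed

theorem theorem3p10:
  fixes n k :: nat
  assumes "1 \<le> n" and "k \<le> n div 2"
  shows "real (rank_number n k) =
    ((real n + 1 - 2 * real k) / (real n + 1 - real k) * real (n choose k))\<^sup>2"
proof -
  define b where "b = n - 1 - k"
  define B where "B = real ((n - 1) choose k) - real ((n - 1) choose (n + 1 - k))"
  have b: "k \<le> Suc b" "k + b = n - 1" "b + 2 = n + 1 - k"
    using assms by (auto simp: b_def)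
  have "card (capped_staircase k b b) + ((n - 1) choose (n + 1 - k)) = (n - 1) choose k"
    using card_capped_staircase[of k b b] b binomial_symmetric[of k "k + b"]
    by (metis add_diff_cancel_left' le_add1 le_refl le_SucI)
  then have right: "real (card (capped_staircase k b b)) = B"
    unfolding B_def by linarith
  have "card (capped_staircase b b k) + ((n - 1) choose (n + 1 - k)) = (n - 1) choose k"
    using card_capped_staircase[of b b k] b by (simp add: add.commute)
  then have below: "real (card (capped_staircase b b k)) = B"
    unfolding B_def by linarith
  have "real (rank_number n k) = B\<^sup>2"
    using rank_number_eq_prod[OF assms, folded b_def] right below by (simp add: power2_eq_square)
  then show ?thesis
    using ballot_number_eq[OF assms] by (simp add: B_def)
qed

end
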